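(* Let $p$ be a prime and let $G$ be a GGS-group acting on the $p$-adic tree with constant defining vector. Then $G$ is strongly fractal but not super strongly fractal.
   Context: The vertices of the $p$-adic tree $T$ are the words in the free monoid $X^*$, where $X=\{x_1,\dots,x_p\}$ (identified with $\{1,\dots,p\}$); the root is the empty word $\emptyset$, and $u$ is joined to $ux$ for $x\in X$. $L_n$ is the set of words of length $n$. $\operatorname{Aut}T$ is the group of automorphisms of the rooted tree $T$, with product $(fg)(u)=g(f(u))$. For $g\in\operatorname{Aut}T$ and a vertex $u$, the section $g_u\in\operatorname{Aut}T$ is defined by $g(uv)=g(u)g_u(v)$ for all $v\in X^*$. For $g$ fixing the first level, $\psi(g)=(g_{x_1},\dots,g_{x_p})$. Let $a$ be the rooted automorphism corresponding to the cycle $(1\,\dots\,p)$, i.e. $a$ permutes the first level by this cycle and has trivial sections at all first-level vertices. Given a non-zero vector $e=(e_1,\dots,e_{p-1})\in(\mathbb{Z}/p\mathbb{Z})^{p-1}$ (the defining vector), define $b\in\operatorname{Aut}T$ fixing the first level recursively by $\psi(b)=(a^{e_1},\dots,a^{e_{p-1}},b)$. The GGS-group with defining vector $e$ is $G=\langle a,b\rangle$. The defining vector is constant if $e_1=\dots=e_{p-1}$. For $G\le\operatorname{Aut}T$, $\operatorname{st}_G(L_n)$ is the subgroup of elements fixing every vertex of $L_n$, and $\psi_u$ is the homomorphism $g\mapsto g_u$ defined on the stabilizer of the vertex $u$. $G$ is self-similar if $g_u\in G$ for all $g\in G$ and all vertices $u$; a self-similar group $G$ is strongly fractal if $\psi_x(\operatorname{st}_G(L_1))=G$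 for every $x\in X$, and super strongly fractal if $\psi_u(\operatorname{st}_G(L_n))=G$ for every $n\in\mathbb{N}$ and every $u\in L_n$. *)

theory Defs
  imports
    "HOL-Algebra.Bij"
    "HOL-Algebra.Generated_Groups"
    "HOL-Number_Theory.Residues"
    "HOL-Combinatorics.Cycles"
begin

section \<open>The rooted tree and its automorphism group\<close>

definition alphabet :: "nat \<Rightarrow> nat set" where
  "alphabet p = {1..p}"

definition words :: "nat \<Rightarrow> nat list set" where
  "words p = lists (alphabet p)"

definition level :: "nat \<Rightarrow> nat \<Rightarrow> nat list set" where
  "level p n = {u \<in> words p. length u = n}"

definition tree_adj :: "nat \<Rightarrow> nat list \<Rightarrow> nat list \<Rightarrow> bool" where
  "tree_adj p u v \<longleftrightarrow> u \<in> words p \<and> v \<in> words p \<and>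
     (\<exists>x\<in>alphabet p. v = u @ [x] \<or> u = v @ [x])"

text \<open>Functions are taken extensional (\<open>undefined\<close> off \<open>words p\<close>), so that equality of
  automorphisms is equality of functions.  The multiplication is opposite to that of
  \<^const>\<open>BijGroup\<close>: here \<open>(f g)(u) = g(f(u))\<close>.\<close>

definition Aut_tree :: "nat \<Rightarrow> (nat list \<Rightarrow> nat list) monoid" where
  "Aut_tree p = \<lparr>
     carrier = {f \<in> Bij (words p). f [] = [] \<and>
       (\<forall>u\<in>words p. \<forall>v\<in>words p. tree_adj p (f u) (f v) \<longleftrightarrow> tree_adj p u v)},
     monoid.mult = (\<lambda>f g. compose (words p) g f),
     one = (\<lambda>u\<in>words p. u)\<rparr>"

text \<open>For \<open>g\<close> in \<open>Aut_tree p\<close> the word \<open>w\<close> exists and is unique, see \<open>section_at_eq\<close> below.\<close>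

definition section_at :: "nat \<Rightarrow> (nat list \<Rightarrow> nat list) \<Rightarrow> nat list \<Rightarrow> (nat list \<Rightarrow> nat list)" where
  "section_at p g u = (\<lambda>v\<in>words p. THE w. g (u @ v) = g u @ w)"

definition level_stabilizer ::
  "nat \<Rightarrow> (nat list \<Rightarrow> nat list) set \<Rightarrow> nat \<Rightarrow> (nat list \<Rightarrow> nat list) set" where
  "level_stabilizer p G n = {g \<in> G. \<forall>u\<in>level p n. g u = u}"


section \<open>Fractality\<close>

definition self_similar :: "nat \<Rightarrow> (nat list \<Rightarrow> nat list) set \<Rightarrow> bool" where
  "self_similar p G \<longleftrightarrow> subgroup G (Aut_tree p) \<and>
     (\<forall>g\<in>G. \<forall>u\<in>words p. section_at p g u \<in> G)"

definition strongly_fractal :: "nat \<Rightarrow> (nat list \<Rightarrow> nat list) set \<Rightarrow> bool" where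
  "strongly_fractal p G \<longleftrightarrow> self_similar p G \<and>
     (\<forall>x\<in>alphabet p. (\<lambda>g. section_at p g [x]) ` level_stabilizer p G 1 = G)"

definition super_strongly_fractal :: "nat \<Rightarrow> (nat list \<Rightarrow> nat list) set \<Rightarrow> bool" where
  "super_strongly_fractal p G \<longleftrightarrow> self_similar p G \<and>
     (\<forall>n. \<forall>u\<in>level p n. (\<lambda>g. section_at p g u) ` level_stabilizer p G n = G)"


section \<open>GGS-groups\<close>

definition rooted_aut :: "nat \<Rightarrow> (nat \<Rightarrow> nat) \<Rightarrow> (nat list \<Rightarrow> nat list)" where
  "rooted_aut p \<sigma> = (\<lambda>u\<in>words p. case u of [] \<Rightarrow> [] | x # w \<Rightarrow> \<sigma> x # w)"

definition ggs_a :: "nat \<Rightarrow> (nat list \<Rightarrow> nat list)" where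
  "ggs_a p = rooted_aut p (cycle_of_list [1..<Suc p])"

text \<open>The ring \<open>\<int>/p\<int>\<close> is represented on \<open>{0..p-1}\<close> by \<^const>\<open>residue_ring\<close>.
  Only non-zero vectors qualify as defining vectors.\<close>

definition defining_vector :: "nat \<Rightarrow> (nat \<Rightarrow> int) \<Rightarrow> bool" where
  "defining_vector p e \<longleftrightarrow> e \<in> {1..p-1} \<rightarrow>\<^sub>E carrier (residue_ring (int p)) \<and>
     (\<exists>i\<in>{1..p-1}. e i \<noteq> \<zero>\<^bsub>residue_ring (int p)\<^esub>)"

definition constant_vector :: "nat \<Rightarrow> (nat \<Rightarrow> int) \<Rightarrow> bool" where
  "constant_vector p e \<longleftrightarrow> (\<forall>i\<in>{1..p-1}. \<forall>j\<in>{1..p-1}. e i = e j)"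

text \<open>The recursion unfolds \<open>\<psi>(b) = (a^(e 1), \<dots>, a^(e (p-1)), b)\<close>; the lemmas
  \<open>section_at_ggs_b\<close> and \<open>section_at_ggs_b_last\<close> below recover it.\<close>

primrec ggs_b_rec :: "nat \<Rightarrow> (nat \<Rightarrow> int) \<Rightarrow> nat list \<Rightarrow> nat list" where
  "ggs_b_rec p e [] = []"
| "ggs_b_rec p e (x # w) =
     x # (if x = p then ggs_b_rec p e w else (ggs_a p [^]\<^bsub>Aut_tree p\<^esub> e x) w)"

definition ggs_b :: "nat \<Rightarrow> (nat \<Rightarrow> int) \<Rightarrow> (nat list \<Rightarrow> nat list)" where
  "ggs_b p e = restrict (ggs_b_rec p e) (words p)"

definition GGS_group :: "nat \<Rightarrow> (nat \<Rightarrow> int) \<Rightarrow> (nat list \<Rightarrow> nat list) set" where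
  "GGS_group p e = generate (Aut_tree p) {ggs_a p, ggs_b p e}"


section \<open>Basic facts\<close>

lemma words_simps [simp]:
  "[] \<in> words p" "x # u \<in> words p \<longleftrightarrow> x \<in> alphabet p \<and> u \<in> words p"
  "u @ v \<in> words p \<longleftrightarrow> u \<in> words p \<and> v \<in> words p"
  by (auto simp: words_def)

lemma Aut_tree_memD:
  assumes "f \<in> carrier (Aut_tree p)"
  shows "f \<in> extensional (words p)" "bij_betw f (words p) (words p)" "f [] = []"
    "\<And>u. u \<in> words p \<Longrightarrow> f u \<in> words p"
    "\<And>u v. u \<in> words p \<Longrightarrow> v \<in> words p \<Longrightarrow> f u = f v \<longleftrightarrow> u = v"
    "\<And>u v. u \<in> words p \<Longrightarrow> v \<in> words p \<Longrightarrow> tree_adj p (f u) (f v) \<longleftrightarrow> tree_adj p u v"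
  using assms by (auto simp: Aut_tree_def Bij_def bij_betw_def inj_on_def)

lemma Aut_tree_snoc:
  assumes f: "f \<in> carrier (Aut_tree p)"
  shows "u @ [x] \<in> words p \<Longrightarrow> \<exists>y\<in>alphabet p. f (u @ [x]) = f u @ [y]"
proof (induction u arbitrary: x rule: rev_induct)
  note D = Aut_tree_memD[OF f]
  have key: "\<exists>y\<in>alphabet p. f (u @ [x]) = f u @ [y] \<or> f u = f (u @ [x]) @ [y]"
    if "u @ [x] \<in> words p" for u x
  proof -
    have "tree_adj p u (u @ [x])" using that by (auto simp: tree_adj_def)
    hence "tree_adj p (f u) (f (u @ [x]))" using D(6)[of u "u @ [x]"] that by simp
    thus ?thesis by (auto simp: tree_adj_def)
  qed
  {
    case Nil
    thus ?case using key[of "[]" x] D(3) by auto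
  next
    case (snoc z u)
    obtain y where y: "f (u @ [z]) = f u @ [y]" using snoc.IH[of z] snoc.prems by auto
    show ?case
    proof (rule ccontr)
      assume "\<not> ?case"
      with key[OF snoc.prems] y have "f ((u @ [z]) @ [x]) = f u" by auto
      hence "(u @ [z]) @ [x] = u" using D(5)[of "(u @ [z]) @ [x]" u] snoc.prems by simp
      thus False by simp
    qed
  }
qed

lemma Aut_tree_memI:
  assumes "f \<in> extensional (words p)" and b: "bij_betw f (words p) (words p)" and n: "f [] = []"
    and s: "\<And>u x. u \<in> words p \<Longrightarrow> x \<in> alphabet p \<Longrightarrow> \<exists>y\<in>alphabet p. f (u @ [x]) = f u @ [y]"
  shows "f \<in> carrier (Aut_tree p)"
proof -
  have m: "f u \<in> words p" if "u \<in> words p" for u using b that by (auto simp: bij_betw_def)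
  have i: "f u = f v \<longleftrightarrow> u = v" if "u \<in> words p" "v \<in> words p" for u v
    using b that by (auto simp: bij_betw_def inj_on_def)
  have one: "v = u @ [x]" if uv: "u \<in> words p" "v \<in> words p" and h: "f v = f u @ [y]"
    and x: "x = last v" for u v x y
  proof (cases v rule: rev_cases)
    case Nil thus ?thesis using h n by simp
  next
    case (snoc v' z)
    with uv s[of v' z] obtain y' where "f v = f v' @ [y']" by auto
    with h have "f v' = f u" by simp
    with i[of v' u] uv snoc x show ?thesis by simp
  qed
  have "tree_adj p (f u) (f v) \<longleftrightarrow> tree_adj p u v" if uv: "u \<in> words p" "v \<in> words p" for u v
  proof
    assume "tree_adj p (f u) (f v)"
    then obtain y where "f v = f u @ [y] \<or> f u = f v @ [y]" by (auto simp: tree_adj_def)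
    hence "v = u @ [last v] \<or> u = v @ [last u]" using one uv by blast
    moreover have "x \<in> alphabet p" if "w @ [x] \<in> words p" for w x using that by simp
    ultimately show "tree_adj p u v" using uv unfolding tree_adj_def by metis
  next
    assume "tree_adj p u v"
    then obtain x where "x \<in> alphabet p" "v = u @ [x] \<or> u = v @ [x]" by (auto simp: tree_adj_def)
    hence "\<exists>y\<in>alphabet p. f v = f u @ [y] \<or> f u = f v @ [y]" using s uv by metis
    thus "tree_adj p (f u) (f v)" using m uv by (auto simp: tree_adj_def)
  qed
  thus ?thesis using assms by (auto simp: Aut_tree_def Bij_def)
qed

lemma group_Aut_tree: "group (Aut_tree p)"
proof (rule groupI)
  fix f g assume f: "f \<in> carrier (Aut_tree p)" and g: "g \<in> carrier (Aut_tree p)"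
  show "f \<otimes>\<^bsub>Aut_tree p\<^esub> g \<in> carrier (Aut_tree p)"
    using Aut_tree_memD[OF f] Aut_tree_memD[OF g] f g
    by (auto simp: Aut_tree_def compose_Bij) (auto simp: compose_def)
next
  show "\<one>\<^bsub>Aut_tree p\<^esub> \<in> carrier (Aut_tree p)"
    by (auto simp: Aut_tree_def id_Bij)
next
  fix f g h assume "f \<in> carrier (Aut_tree p)" "g \<in> carrier (Aut_tree p)" "h \<in> carrier (Aut_tree p)"
  thus "f \<otimes>\<^bsub>Aut_tree p\<^esub> g \<otimes>\<^bsub>Aut_tree p\<^esub> h = f \<otimes>\<^bsub>Aut_tree p\<^esub> (g \<otimes>\<^bsub>Aut_tree p\<^esub> h)"
    using Aut_tree_memD(4) by (auto simp: Aut_tree_def compose_def fun_eq_iff)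
next
  fix f assume f: "f \<in> carrier (Aut_tree p)"
  note D = Aut_tree_memD[OF f]
  show "\<one>\<^bsub>Aut_tree p\<^esub> \<otimes>\<^bsub>Aut_tree p\<^esub> f = f"
    using D(1) by (auto simp: Aut_tree_def compose_def fun_eq_iff extensional_def)
  define g where "g = restrict (inv_into (words p) f) (words p)"
  have gB: "g \<in> Bij (words p)"
    using D(1,2) unfolding g_def by (intro restrict_inv_into_Bij) (simp add: Bij_def)
  have fg: "f (g u) = u" "g u \<in> words p" if "u \<in> words p" for u
    using that D(2) by (auto simp: g_def bij_betw_inv_into_right bij_betw_def inv_into_into f_inv_into_f)
  have gf: "g (f u) = u" if "u \<in> words p" for u
    using that D(2,4) by (auto simp: g_def bij_betw_inv_into_left)
  have "g [] = []" using gf[of "[]"] D(3) by simp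
  moreover have "tree_adj p (g u) (g v) \<longleftrightarrow> tree_adj p u v" if "u \<in> words p" "v \<in> words p" for u v
    using D(6)[of "g u" "g v"] fg that by simp
  ultimately have "g \<in> carrier (Aut_tree p)" using gB by (auto simp: Aut_tree_def)
  moreover have "g \<otimes>\<^bsub>Aut_tree p\<^esub> f = \<one>\<^bsub>Aut_tree p\<^esub>"
    using fg by (auto simp: Aut_tree_def compose_def fun_eq_iff)
  ultimately show "\<exists>g\<in>carrier (Aut_tree p). g \<otimes>\<^bsub>Aut_tree p\<^esub> f = \<one>\<^bsub>Aut_tree p\<^esub>" by blast
qed

lemma Aut_tree_prefix:
  assumes f: "f \<in> carrier (Aut_tree p)" and u: "u \<in> words p"
  shows "v \<in> words p \<Longrightarrow> \<exists>w\<in>words p. length w = length v \<and> f (u @ v) = f u @ w"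
proof (induction v rule: rev_induct)
  case Nil thus ?case by auto
next
  case (snoc x v)
  then obtain w where w: "w \<in> words p" "length w = length v" "f (u @ v) = f u @ w" by auto
  obtain y where "y \<in> alphabet p" "f ((u @ v) @ [x]) = f (u @ v) @ [y]"
    using Aut_tree_snoc[OF f, of "u @ v" x] snoc.prems u by auto
  with w show ?case by (intro bexI[of _ "w @ [y]"]) auto
qed

lemma Aut_tree_length:
  assumes "f \<in> carrier (Aut_tree p)" "u \<in> words p"
  shows "length (f u) = length u"
  using Aut_tree_prefix[OF assms(1), of "[]" u] assms Aut_tree_memD(3)[OF assms(1)] by auto

lemma section_at_eq:
  assumes "g \<in> carrier (Aut_tree p)" "u \<in> words p" "v \<in> words p"
  shows "g (u @ v) = g u @ section_at p g u v"
  using Aut_tree_prefix[OF assms] assms(3) by (auto simp: section_at_def)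

lemma section_at_closed:
  assumes g: "g \<in> carrier (Aut_tree p)" and u: "u \<in> words p"
  shows "section_at p g u \<in> carrier (Aut_tree p)"
proof (rule Aut_tree_memI)
  let ?s = "section_at p g u"
  note D = Aut_tree_memD[OF g] and E = section_at_eq[OF g u]
  have m: "?s v \<in> words p" if "v \<in> words p" for v
    using D(4)[of "u @ v"] E[OF that] u that by simp
  show "?s \<in> extensional (words p)" by (simp add: section_at_def)
  show "?s [] = []" using E[of "[]"] by simp
  have "inj_on ?s (words p)"
  proof (rule inj_onI)
    fix v w assume vw: "v \<in> words p" "w \<in> words p" "?s v = ?s w"
    hence "g (u @ v) = g (u @ w)" using E by simp
    thus "v = w" using D(5)[of "u @ v" "u @ w"] u vw by simp
  qed
  moreover have "w \<in> ?s ` words p" if w: "w \<in> words p" for w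
  proof -
    have "g u @ w \<in> words p" using w D(4) u by simp
    then obtain t where t: "t \<in> words p" "g t = g u @ w"
      using D(2) unfolding bij_betw_def by (metis imageE)
    define t1 t2 where "t1 = take (length u) t" and "t2 = drop (length u) t"
    have tt: "t = t1 @ t2" by (simp add: t1_def t2_def)
    with t have T: "t1 \<in> words p" "t2 \<in> words p" by auto
    have len: "length t = length u + length w"
      using Aut_tree_length[OF g t(1)] Aut_tree_length[OF g u] t(2) by simp
    have "length (g t1) = length (g u)"
      using Aut_tree_length[OF g T(1)] Aut_tree_length[OF g u] len by (simp add: t1_def)
    moreover have "g t1 @ section_at p g t1 t2 = g u @ w"
      using section_at_eq[OF g T] t(2) tt by simp
    ultimately have "g t1 = g u" by simp
    hence "t1 = u" using D(5) T u by simp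
    hence "?s t2 = w" using E[OF T(2)] t(2) tt by simp
    thus ?thesis using T by blast
  qed
  ultimately show "bij_betw ?s (words p) (words p)" using m by (auto simp: bij_betw_def)
  fix v x assume v: "v \<in> words p" "x \<in> alphabet p"
  then obtain y where "y \<in> alphabet p" "g ((u @ v) @ [x]) = g (u @ v) @ [y]"
    using Aut_tree_snoc[OF g, of "u @ v" x] u by auto
  thus "\<exists>y\<in>alphabet p. ?s (v @ [x]) = ?s v @ [y]"
    using E[of "v @ [x]"] E[of v] v by auto
qed

lemma rooted_aut_closed:
  assumes s: "\<sigma> permutes alphabet p"
  shows "rooted_aut p \<sigma> \<in> carrier (Aut_tree p)"
proof (rule Aut_tree_memI)
  let ?f = "rooted_aut p \<sigma>"
  have c: "?f (x # w) = \<sigma> x # w" if "x \<in> alphabet p" "w \<in> words p" for x w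
    using that by (simp add: rooted_aut_def)
  have n: "?f [] = []" by (simp add: rooted_aut_def)
  have sm: "\<sigma> x \<in> alphabet p \<longleftrightarrow> x \<in> alphabet p" for x using s by (rule permutes_in_image)
  show "?f \<in> extensional (words p)" by (simp add: rooted_aut_def)
  show "?f [] = []" by (fact n)
  have "inj_on ?f (words p)"
  proof (rule inj_onI)
    fix v w assume "v \<in> words p" "w \<in> words p" "?f v = ?f w"
    thus "v = w" using permutes_inj[OF s]
      by (cases v; cases w) (auto simp: c n inj_def)
  qed
  moreover have "?f w \<in> words p" if "w \<in> words p" for w
    using that by (cases w) (auto simp: c n sm)
  moreover have "w \<in> ?f ` words p" if "w \<in> words p" for w
  proof (cases w)
    case Nil thus ?thesis using n by (intro image_eqI[of _ _ "[]"]) auto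
  next
    case (Cons y v)
    hence "y \<in> alphabet p" "v \<in> words p" using that by auto
    moreover then obtain x where "x \<in> alphabet p" "y = \<sigma> x"
      using permutes_image[OF s] by blast
    ultimately show ?thesis using Cons c by (intro image_eqI[of _ _ "x # v"]) auto
  qed
  ultimately show "bij_betw ?f (words p) (words p)" by (auto simp: bij_betw_def)
  fix u x assume "u \<in> words p" "x \<in> alphabet p"
  thus "\<exists>y\<in>alphabet p. ?f (u @ [x]) = ?f u @ [y]"
    by (cases u) (auto simp: c n sm)
qed

lemma ggs_a_closed: "ggs_a p \<in> carrier (Aut_tree p)"
proof -
  have "set [1..<Suc p] = alphabet p" by (auto simp: alphabet_def)
  thus ?thesis using cycle_permutes[of "[1..<Suc p]"] unfolding ggs_a_def
    by (intro rooted_aut_closed) simp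
qed

lemma ggs_a_pow_closed: "ggs_a p [^]\<^bsub>Aut_tree p\<^esub> (k::int) \<in> carrier (Aut_tree p)"
  using group.int_pow_closed[OF group_Aut_tree ggs_a_closed] .

lemma ggs_b_closed: "ggs_b p e \<in> carrier (Aut_tree p)"
proof (rule Aut_tree_memI)
  let ?f = "ggs_b p e"
  note A = Aut_tree_memD[OF ggs_a_pow_closed]
  have e: "?f w = ggs_b_rec p e w" if "w \<in> words p" for w using that by (simp add: ggs_b_def)
  have m: "ggs_b_rec p e w \<in> words p" if "w \<in> words p" for w
    using that by (induction w) (auto simp: A(4))
  have i: "ggs_b_rec p e v = ggs_b_rec p e w \<Longrightarrow> v = w" if "v \<in> words p" "w \<in> words p" for v w
    using that
  proof (induction v arbitrary: w)
    case Nil thus ?case by (cases w) auto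
  next
    case (Cons x v) thus ?case by (cases w) (auto simp: A(5) split: if_splits)
  qed
  have s: "w \<in> ggs_b_rec p e ` words p" if "w \<in> words p" for w using that
  proof (induction w)
    case Nil show ?case by (rule image_eqI[of _ _ "[]"]) auto
  next
    case (Cons y w)
    hence w: "w \<in> words p" "y \<in> alphabet p" by auto
    have "\<exists>v\<in>words p. ggs_b_rec p e (y # v) = y # w"
    proof (cases "y = p")
      case True thus ?thesis using Cons w by auto
    next
      case False
      have "w \<in> (ggs_a p [^]\<^bsub>Aut_tree p\<^esub> e y) ` words p"
        using A(2)[of p "e y"] w unfolding bij_betw_def by simp
      thus ?thesis using False by auto
    qed
    then obtain v where "v \<in> words p" "ggs_b_rec p e (y # v) = y # w" by blast
    thus ?case using w by (intro image_eqI[of _ _ "y # v"]) auto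
  qed
  show "?f \<in> extensional (words p)" "?f [] = []" by (simp_all add: ggs_b_def)
  have "bij_betw (ggs_b_rec p e) (words p) (words p)"
    using m i s by (auto simp: bij_betw_def inj_on_def)
  thus "bij_betw ?f (words p) (words p)" using e bij_betw_cong by metis
  fix u x assume ux: "u \<in> words p" "x \<in> alphabet p"
  hence "\<exists>y\<in>alphabet p. ggs_b_rec p e (u @ [x]) = ggs_b_rec p e u @ [y]"
  proof (induction u)
    case Nil thus ?case by (auto simp: A(3))
  next
    case (Cons z u) thus ?case using Aut_tree_snoc[OF ggs_a_pow_closed, of u x p "e z"] by auto
  qed
  thus "\<exists>y\<in>alphabet p. ?f (u @ [x]) = ?f u @ [y]" using e ux by simp
qed

lemma section_at_ggs_b:
  assumes "x \<in> alphabet p" "x \<noteq> p"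
  shows "section_at p (ggs_b p e) [x] = ggs_a p [^]\<^bsub>Aut_tree p\<^esub> e x"
  using assms Aut_tree_memD(1,3)[OF ggs_a_pow_closed[of p "e x"]]
  by (auto simp: fun_eq_iff section_at_def ggs_b_def extensional_def)

lemma section_at_ggs_b_last:
  assumes "p > 0"
  shows "section_at p (ggs_b p e) [p] = ggs_b p e"
  using assms by (auto simp: fun_eq_iff section_at_def ggs_b_def alphabet_def)

end

theory Submission
  imports Defs
begin

text \<open>
  Strong fractality: conjugating \<open>b\<close> by powers of \<open>a\<close> brings any of its first-level sections to any
  vertex of the first level. So the sections at a given vertex of the first-level stabilizer contain
  \<open>b\<close> and some \<open>a\<^sup>c\<close> with \<open>c\<close> not divisible by \<open>p\<close>, and these generate the whole group
  (\<open>strongly_fractal_GGS\<close>).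

  Super strong fractality already fails on the second level. Let all entries of the vector be \<open>c\<close>.
  All generators act at each vertex by a power of the cycle \<open>(1 \<dots> p)\<close>, so an element \<open>g\<close> has a
  rotation number \<open>\<alpha> g\<close> in \<open>\<int>/p\<int>\<close> at the root and a sum \<open>\<beta> g\<close> of the rotation numbers on the first
  level. Both are homomorphisms, and hence so is the weight \<open>\<alpha> - \<beta>\<close>. It takes the values
  \<open>1\<close> at \<open>a\<close> and \<open>-(p - 1) c = c\<close> at \<open>b\<close>. Since \<open>a\<^sup>c\<close> and \<open>b\<close> both have weight \<open>c\<close>, all
  first-level sections of an element \<open>g\<close> of the group have the same weight, namely \<open>c\<close> times
  the exponent sum of \<open>b\<close> in a word for \<open>g\<close>, and this is \<open>- \<beta> g\<close> (\<open>GGS_weight_balanced\<close>). If \<open>g\<close> fixes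
  the second level, then \<open>\<alpha>\<close> vanishes at \<open>g\<close> and at its first-level sections, so
  the weights of \<open>g\<close>, of its first-level sections and of its second-level sections all agree; they
  are zero because \<open>\<beta> g = 0\<close> too (\<open>level_stabilizer_2_section_weight\<close>). As \<open>a\<close> has weight \<open>1\<close>, it
  is not a second-level section of such an element.
\<close>

section \<open>Sections of products and inverses\<close>

interpretation Aut: group "Aut_tree p" for p
  by (rule group_Aut_tree)

lemma Aut_tree_mult_apply:
  "u \<in> words p \<Longrightarrow> (f \<otimes>\<^bsub>Aut_tree p\<^esub> g) u = g (f u)"
  by (simp add: Aut_tree_def compose_def)

lemma Aut_tree_one_apply: "u \<in> words p \<Longrightarrow> \<one>\<^bsub>Aut_tree p\<^esub> u = u"
  by (simp add: Aut_tree_def)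

lemma Aut_tree_inv_apply:
  assumes "g \<in> carrier (Aut_tree p)" "u \<in> words p"
  shows "g ((inv\<^bsub>Aut_tree p\<^esub> g) u) = u" "(inv\<^bsub>Aut_tree p\<^esub> g) (g u) = u"
  using assms Aut_tree_mult_apply[of u p "inv\<^bsub>Aut_tree p\<^esub> g" g]
    Aut_tree_mult_apply[of u p g "inv\<^bsub>Aut_tree p\<^esub> g"]
  by (simp_all add: Aut_tree_one_apply)

lemma Aut_tree_eqI:
  assumes "f \<in> carrier (Aut_tree p)" "g \<in> carrier (Aut_tree p)"
    and "\<And>u. u \<in> words p \<Longrightarrow> f u = g u"
  shows "f = g"
  using assms by (meson Aut_tree_memD(1) extensionalityI)

lemma section_at_unique:
  assumes "g \<in> carrier (Aut_tree p)" "u \<in> words p" "s \<in> carrier (Aut_tree p)"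
    and "\<And>v. v \<in> words p \<Longrightarrow> g (u @ v) = g u @ s v"
  shows "section_at p g u = s"
  using assms section_at_eq[OF assms(1,2)] section_at_closed[OF assms(1,2)]
  by (intro Aut_tree_eqI[of _ p]) auto

lemma section_at_mult:
  assumes f: "f \<in> carrier (Aut_tree p)" and g: "g \<in> carrier (Aut_tree p)" and u: "u \<in> words p"
  shows "section_at p (f \<otimes>\<^bsub>Aut_tree p\<^esub> g) u =
         section_at p f u \<otimes>\<^bsub>Aut_tree p\<^esub> section_at p g (f u)"
proof (rule section_at_unique)
  have fu: "f u \<in> words p" using Aut_tree_memD(4)[OF f] u .
  note s = section_at_closed[OF f u] section_at_closed[OF g fu]
  show "f \<otimes>\<^bsub>Aut_tree p\<^esub> g \<in> carrier (Aut_tree p)" using f g by simp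
  show "section_at p f u \<otimes>\<^bsub>Aut_tree p\<^esub> section_at p g (f u) \<in> carrier (Aut_tree p)"
    using s by simp
  fix v assume v: "v \<in> words p"
  show "(f \<otimes>\<^bsub>Aut_tree p\<^esub> g) (u @ v) = (f \<otimes>\<^bsub>Aut_tree p\<^esub> g) u @
    (section_at p f u \<otimes>\<^bsub>Aut_tree p\<^esub> section_at p g (f u)) v"
    using u v fu Aut_tree_memD(4)[OF s(1) v]
    by (simp add: Aut_tree_mult_apply section_at_eq[OF f u v] section_at_eq[OF g fu])
qed (fact u)

lemma section_at_one: "u \<in> words p \<Longrightarrow> section_at p \<one>\<^bsub>Aut_tree p\<^esub> u = \<one>\<^bsub>Aut_tree p\<^esub>"
  by (rule section_at_unique) (simp_all add: Aut_tree_one_apply)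

lemma section_at_inv:
  assumes g: "g \<in> carrier (Aut_tree p)" and u: "u \<in> words p"
  shows "section_at p (inv\<^bsub>Aut_tree p\<^esub> g) u =
         inv\<^bsub>Aut_tree p\<^esub> (section_at p g ((inv\<^bsub>Aut_tree p\<^esub> g) u))"
proof -
  have i: "inv\<^bsub>Aut_tree p\<^esub> g \<in> carrier (Aut_tree p)" using g by simp
  have w: "(inv\<^bsub>Aut_tree p\<^esub> g) u \<in> words p" using Aut_tree_memD(4)[OF i u] .
  have "section_at p (inv\<^bsub>Aut_tree p\<^esub> g) u \<otimes>\<^bsub>Aut_tree p\<^esub>
        section_at p g ((inv\<^bsub>Aut_tree p\<^esub> g) u) = \<one>\<^bsub>Aut_tree p\<^esub>"
    using section_at_mult[OF i g u] section_at_one[OF u] g by simp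
  thus ?thesis
    using section_at_closed[OF i u] section_at_closed[OF g w] by (metis Aut.inv_equality)
qed

lemma section_at_Nil: "g \<in> carrier (Aut_tree p) \<Longrightarrow> section_at p g [] = g"
  by (rule section_at_unique) (auto simp: Aut_tree_memD(3))

lemma section_at_append:
  assumes g: "g \<in> carrier (Aut_tree p)" and u: "u \<in> words p" and v: "v \<in> words p"
  shows "section_at p g (u @ v) = section_at p (section_at p g u) v"
proof (rule section_at_unique)
  note s = section_at_closed[OF g u]
  show "section_at p (section_at p g u) v \<in> carrier (Aut_tree p)" using section_at_closed[OF s v] .
  fix w assume w: "w \<in> words p"
  show "g ((u @ v) @ w) = g (u @ v) @ section_at p (section_at p g u) v w"
    using u v w section_at_eq[OF g u, of "v @ w"] section_at_eq[OF g u v] section_at_eq[OF s v w]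
    by simp
qed (use assms in auto)

text \<open>Sections obey cocycle rules, in which the vertex is moved by the automorphism. This is why
  \<open>U\<close> has to be invariant. It is applied below to a level and to the set of all vertices.\<close>

lemma subgroup_sections_in:
  assumes H: "subgroup H (Aut_tree p)" and U: "U \<subseteq> words p"
    and inv: "\<And>g u. g \<in> carrier (Aut_tree p) \<Longrightarrow> u \<in> U \<Longrightarrow> g u \<in> U"
  shows "subgroup {g \<in> carrier (Aut_tree p). \<forall>u\<in>U. section_at p g u \<in> H} (Aut_tree p)"
    (is "subgroup ?S _")
proof (rule Aut.subgroupI)
  show "?S \<subseteq> carrier (Aut_tree p)" by blast
  have "section_at p \<one>\<^bsub>Aut_tree p\<^esub> u \<in> H" if "u \<in> U" for u
    using section_at_one[of u p] subgroup.one_closed[OF H] U that by auto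
  hence "\<one>\<^bsub>Aut_tree p\<^esub> \<in> ?S" by blast
  thus "?S \<noteq> {}" by blast
next
  fix g assume g: "g \<in> ?S"
  hence c: "g \<in> carrier (Aut_tree p)" "inv\<^bsub>Aut_tree p\<^esub> g \<in> carrier (Aut_tree p)" by auto
  have "section_at p (inv\<^bsub>Aut_tree p\<^esub> g) u \<in> H" if u: "u \<in> U" for u
  proof -
    have "section_at p g ((inv\<^bsub>Aut_tree p\<^esub> g) u) \<in> H" using inv[OF c(2) u] g by blast
    hence "inv\<^bsub>Aut_tree p\<^esub> (section_at p g ((inv\<^bsub>Aut_tree p\<^esub> g) u)) \<in> H"
      by (rule subgroup.m_inv_closed[OF H])
    moreover have "u \<in> words p" using U u by blast
    ultimately show ?thesis by (simp only: section_at_inv[OF c(1)])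
  qed
  thus "inv\<^bsub>Aut_tree p\<^esub> g \<in> ?S" using c(2) by blast
next
  fix f g assume f: "f \<in> ?S" and g: "g \<in> ?S"
  hence c: "f \<in> carrier (Aut_tree p)" "g \<in> carrier (Aut_tree p)" by auto
  have "section_at p (f \<otimes>\<^bsub>Aut_tree p\<^esub> g) u \<in> H" if u: "u \<in> U" for u
  proof -
    have "section_at p f u \<in> H" "section_at p g (f u) \<in> H"
      using inv[OF c(1) u] f g u by blast+
    hence "section_at p f u \<otimes>\<^bsub>Aut_tree p\<^esub> section_at p g (f u) \<in> H"
      by (rule subgroup.m_closed[OF H])
    moreover have "u \<in> words p" using U u by blast
    ultimately show ?thesis by (simp only: section_at_mult[OF c])
  qed
  thus "f \<otimes>\<^bsub>Aut_tree p\<^esub> g \<in> ?S" using c by simp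
qed

lemma Aut_tree_letter:
  assumes "g \<in> carrier (Aut_tree p)" "x \<in> alphabet p"
  obtains y where "y \<in> alphabet p" "g [x] = [y]"
  using Aut_tree_snoc[OF assms(1), of "[]" x] assms(2) Aut_tree_memD(3)[OF assms(1)] by auto

lemma level_Suc_0: "level p (Suc 0) = (\<lambda>x. [x]) ` alphabet p"
  by (auto simp: level_def length_Suc_conv)


section \<open>Powers of the rooted generator\<close>

text \<open>The letters \<open>1, \<dots>, p\<close> are representatives of the residues modulo \<open>p\<close>, with \<open>p\<close> standing
  for zero. In these terms the cycle \<open>(1 \<dots> p)\<close> is the addition of one.\<close>

lemma alphabet_residue:
  assumes "p > 0"
  obtains y where "y \<in> alphabet p" "[int y = k] (mod int p)"
proof
  let ?y = "nat ((k - 1) mod int p) + 1"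
  have b: "0 \<le> (k - 1) mod int p" "(k - 1) mod int p < int p" using assms by auto
  show "?y \<in> alphabet p" using b by (auto simp: alphabet_def nat_less_iff Suc_le_eq)
  have "int ?y = (k - 1) mod int p + 1" using b by simp
  also have "[\<dots> = k - 1 + 1] (mod int p)" by (intro cong_add) (simp_all add: cong_def)
  finally show "[int ?y = k] (mod int p)" by simp
qed

lemma alphabet_cong_imp_eq:
  assumes "x \<in> alphabet p" "y \<in> alphabet p" "[int x = int y] (mod int p)"
  shows "x = y"
proof -
  have "[int x - 1 = int y - 1] (mod int p)" using assms(3) by (rule cong_diff) simp
  moreover have "0 \<le> int x - 1" "int x - 1 < int p" "0 \<le> int y - 1" "int y - 1 < int p"
    using assms(1,2) by (auto simp: alphabet_def)
  ultimately show ?thesis by (simp add: cong_def)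
qed

lemma ggs_a_Cons:
  assumes "x \<in> alphabet p" "w \<in> words p" "y \<in> alphabet p" "[int y = int x + 1] (mod int p)"
  shows "ggs_a p (x # w) = y # w"
proof -
  \<comment> \<open>The letter \<open>x\<close> is the entry of the list at position \<open>x - 1\<close>, hence its successor is
    \<open>1 + x mod p\<close>.\<close>
  let ?cs = "[1..<Suc p]" and ?c = "cycle_of_list [1..<Suc p]"
  have l: "length ?cs = p" by simp
  have x: "x - 1 < length ?cs" "?cs ! (x - 1) = x"
    using assms(1) by (auto simp: alphabet_def simp del: upt_Suc)
  have "map ?c ?cs = rotate1 ?cs" using cyclic_rotation[of ?cs 1] by (simp del: upt_Suc)
  hence "?c x = rotate1 ?cs ! (x - 1)" using x by (metis nth_map)
  also have "\<dots> = ?cs ! (Suc (x - 1) mod p)" using x l by (metis nth_rotate1)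
  also have "\<dots> = 1 + x mod p" using assms(1) by (simp add: alphabet_def del: upt_Suc)
  finally have c: "?c x = 1 + x mod p" .
  have "1 + x mod p \<in> alphabet p" using assms(1) by (auto simp: alphabet_def Suc_le_eq)
  moreover have "[int (1 + x mod p) = int y] (mod int p)"
    using assms(4) by (simp add: cong_def zmod_int mod_add_right_eq add.commute)
  ultimately have "1 + x mod p = y" using assms(3) alphabet_cong_imp_eq by blast
  thus ?thesis using assms c by (simp add: ggs_a_def rooted_aut_def del: upt_Suc)
qed

lemma ggs_a_pow_Cons:
  assumes x: "x \<in> alphabet p" and w: "w \<in> words p" and y: "y \<in> alphabet p"
    and c: "[int y = int x + k] (mod int p)"
  shows "(ggs_a p [^]\<^bsub>Aut_tree p\<^esub> (k::int)) (x # w) = y # w"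
proof -
  have p: "p > 0" using x by (auto simp: alphabet_def)
  have nat: "(ggs_a p [^]\<^bsub>Aut_tree p\<^esub> n) (x # w) = y # w"
    if "x \<in> alphabet p" "y \<in> alphabet p" "[int y = int x + int n] (mod int p)" for n :: nat and x y
    using that
  proof (induction n arbitrary: y)
    case 0
    hence "y = x" using alphabet_cong_imp_eq by simp
    thus ?case using 0 w by (simp add: Aut_tree_one_apply)
  next
    case (Suc n)
    obtain z where z: "z \<in> alphabet p" "[int z = int x + int n] (mod int p)"
      using alphabet_residue[OF p] .
    have "[int z + 1 = int y] (mod int p)"
      using cong_add[OF z(2) cong_refl[of 1]] Suc.prems(3)
      by (metis cong_sym cong_trans of_nat_Suc add.commute add.assoc)
    hence "ggs_a p (z # w) = y # w" using cong_sym[of "int z + 1" "int y" "int p"] z Suc.prems w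
      by (intro ggs_a_Cons) auto
    thus ?case using Suc.IH[OF Suc.prems(1) z] Suc.prems(1) w
      by (simp add: Aut_tree_mult_apply)
  qed
  show ?thesis
  proof (cases k)
    case (nonneg n)
    thus ?thesis using nat x y c by (simp add: int_pow_int)
  next
    case (neg n)
    let ?g = "ggs_a p [^]\<^bsub>Aut_tree p\<^esub> Suc n"
    have "[int x = int y + int (Suc n)] (mod int p)"
      using cong_sym[OF cong_add[OF c cong_refl[of "int (Suc n)"]]] neg by simp
    hence "?g (y # w) = x # w" using nat x y by blast
    moreover have "?g \<in> carrier (Aut_tree p)" using ggs_a_closed by (rule Aut.nat_pow_closed)
    ultimately have "(inv\<^bsub>Aut_tree p\<^esub> ?g) (x # w) = y # w"
      using Aut_tree_inv_apply(2)[of ?g p "y # w"] y w by simp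
    thus ?thesis using neg by (simp only: Aut.int_pow_neg_int[OF ggs_a_closed])
  qed
qed

lemma ggs_a_pow_cong:
  assumes "p > 0" "[k = l] (mod int p)"
  shows "ggs_a p [^]\<^bsub>Aut_tree p\<^esub> k = ggs_a p [^]\<^bsub>Aut_tree p\<^esub> l"
proof (rule Aut_tree_eqI)
  fix u assume u: "u \<in> words p"
  show "(ggs_a p [^]\<^bsub>Aut_tree p\<^esub> k) u = (ggs_a p [^]\<^bsub>Aut_tree p\<^esub> l) u"
  proof (cases u)
    case Nil
    thus ?thesis by (simp add: Aut_tree_memD(3)[OF ggs_a_pow_closed])
  next
    case (Cons x w)
    obtain y where y: "y \<in> alphabet p" "[int y = int x + k] (mod int p)"
      using alphabet_residue[OF assms(1)] .
    moreover have "[int y = int x + l] (mod int p)"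
      using y(2) cong_add[OF cong_refl assms(2)] cong_trans by blast
    ultimately show ?thesis using u Cons by (simp add: ggs_a_pow_Cons)
  qed
qed (rule ggs_a_pow_closed)+

lemma section_at_ggs_a_pow:
  assumes "x \<in> alphabet p"
  shows "section_at p (ggs_a p [^]\<^bsub>Aut_tree p\<^esub> (k::int)) [x] = \<one>\<^bsub>Aut_tree p\<^esub>"
proof (rule section_at_unique[OF ggs_a_pow_closed])
  fix v assume v: "v \<in> words p"
  have "p > 0" using assms by (auto simp: alphabet_def)
  then obtain y where "y \<in> alphabet p" "[int y = int x + k] (mod int p)"
    by (rule alphabet_residue)
  thus "(ggs_a p [^]\<^bsub>Aut_tree p\<^esub> k) ([x] @ v) = (ggs_a p [^]\<^bsub>Aut_tree p\<^esub> k) [x] @ \<one>\<^bsub>Aut_tree p\<^esub> v"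
    using assms v by (simp add: ggs_a_pow_Cons Aut_tree_one_apply)
qed (use assms in auto)

lemma ggs_a_pow_1: "ggs_a p [^]\<^bsub>Aut_tree p\<^esub> (1::int) = ggs_a p"
  using Aut.int_pow_1[OF ggs_a_closed] .


section \<open>Self-similarity and strong fractality\<close>

lemma subgroup_GGS: "subgroup (GGS_group p e) (Aut_tree p)"
  unfolding GGS_group_def
  by (rule Aut.generate_is_subgroup) (auto simp: ggs_a_closed ggs_b_closed)

lemma ggs_generators_in: "ggs_a p \<in> GGS_group p e" "ggs_b p e \<in> GGS_group p e"
  by (auto simp: GGS_group_def intro: generate.incl)

lemma GGS_subset:
  assumes "subgroup H (Aut_tree p)" "ggs_a p \<in> H" "ggs_b p e \<in> H"
  shows "GGS_group p e \<subseteq> H"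
  unfolding GGS_group_def using assms by (intro Aut.generate_subgroup_incl) auto

lemma ggs_a_pow_in_GGS: "ggs_a p [^]\<^bsub>Aut_tree p\<^esub> (k::int) \<in> GGS_group p e"
  using Aut.subgroup_int_pow_closed[OF subgroup_GGS ggs_generators_in(1)] .

lemma section_at_ggs_a: "x \<in> alphabet p \<Longrightarrow> section_at p (ggs_a p) [x] = \<one>\<^bsub>Aut_tree p\<^esub>"
  using section_at_ggs_a_pow[of x p 1] by (simp add: ggs_a_pow_1)

lemma section_at_ggs_b_cases:
  assumes "x \<in> alphabet p"
  shows "section_at p (ggs_b p e) [x] =
    (if x = p then ggs_b p e else ggs_a p [^]\<^bsub>Aut_tree p\<^esub> e x)"
  using assms section_at_ggs_b[OF assms] section_at_ggs_b_last[of p e]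
  by (auto simp: alphabet_def)

lemma ggs_b_letter: "x \<in> alphabet p \<Longrightarrow> ggs_b p e [x] = [x]"
  using Aut_tree_memD(3)[OF ggs_a_pow_closed] by (simp add: ggs_b_def)

text \<open>On the first level it is enough to look at the generators; deeper sections are iterated
  first-level sections.\<close>

lemma self_similar_GGS: "self_similar p (GGS_group p e)"
proof -
  let ?G = "GGS_group p e"
  let ?D = "{g \<in> carrier (Aut_tree p). \<forall>u\<in>level p 1. section_at p g u \<in> ?G}"
  have "subgroup ?D (Aut_tree p)"
    by (rule subgroup_sections_in[OF subgroup_GGS])
       (auto simp: level_def Aut_tree_length Aut_tree_memD(4))
  moreover have "ggs_a p \<in> ?D"
    by (auto simp: level_Suc_0 ggs_a_closed section_at_ggs_a
        subgroup.one_closed[OF subgroup_GGS])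
  moreover have "ggs_b p e \<in> ?D"
    by (auto simp: level_Suc_0 ggs_b_closed section_at_ggs_b_cases ggs_generators_in
        ggs_a_pow_in_GGS)
  ultimately have "?G \<subseteq> ?D" by (rule GGS_subset)
  hence first: "section_at p g [x] \<in> ?G" if "g \<in> ?G" "x \<in> alphabet p" for g x
    using that by (auto simp: level_Suc_0)
  have "section_at p g u \<in> ?G" if "g \<in> ?G" "u \<in> words p" for g u
    using that
  proof (induction u arbitrary: g)
    case Nil
    thus ?case using section_at_Nil[OF subgroup.mem_carrier[OF subgroup_GGS Nil(1)]] by simp
  next
    case (Cons x u)
    have "g \<in> carrier (Aut_tree p)" using subgroup.mem_carrier[OF subgroup_GGS Cons.prems(1)] .
    hence "section_at p g (x # u) = section_at p (section_at p g [x]) u"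
      using section_at_append[of g p "[x]" u] Cons.prems by simp
    thus ?case using Cons first by simp
  qed
  thus ?thesis by (simp add: self_similar_def subgroup_GGS)
qed

text \<open>Conjugation by \<open>a\<^sup>k\<close> keeps \<open>b\<close> in the first-level stabilizer and moves its sections
  cyclically by \<open>k\<close> places, since \<open>a\<^sup>k\<close> itself has trivial sections on the first level.\<close>

lemma ggs_b_section_transport:
  assumes x: "x \<in> alphabet p" and y: "y \<in> alphabet p"
  obtains g where "g \<in> level_stabilizer p (GGS_group p e) 1"
    "section_at p g [x] = section_at p (ggs_b p e) [y]"
proof
  let ?k = "int y - int x" and ?b = "ggs_b p e"
  let ?a = "ggs_a p [^]\<^bsub>Aut_tree p\<^esub> ?k"
  let ?g = "?a \<otimes>\<^bsub>Aut_tree p\<^esub> ?b \<otimes>\<^bsub>Aut_tree p\<^esub> inv\<^bsub>Aut_tree p\<^esub> ?a"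
  have c: "?a \<in> carrier (Aut_tree p)" "inv\<^bsub>Aut_tree p\<^esub> ?a \<in> carrier (Aut_tree p)"
    "?a \<otimes>\<^bsub>Aut_tree p\<^esub> ?b \<in> carrier (Aut_tree p)"
    using ggs_a_pow_closed[of p ?k] ggs_b_closed by auto
  have axy: "?a [x] = [y]" using ggs_a_pow_Cons[OF x _ y, of "[]" ?k] by simp
  have "?g \<in> GGS_group p e"
    using ggs_generators_in ggs_a_pow_in_GGS subgroup_GGS
    by (intro subgroup.m_closed subgroup.m_inv_closed) auto
  moreover have "?g [z] = [z]" if z: "z \<in> alphabet p" for z
  proof -
    obtain t where t: "t \<in> alphabet p" "?a [z] = [t]" using Aut_tree_letter[OF c(1) z] .
    thus ?thesis using Aut_tree_inv_apply(2)[OF c(1), of "[z]"] z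
      by (simp add: Aut_tree_mult_apply ggs_b_letter)
  qed
  ultimately show "?g \<in> level_stabilizer p (GGS_group p e) 1"
    by (simp add: level_stabilizer_def level_Suc_0)
  have i: "(inv\<^bsub>Aut_tree p\<^esub> ?a) [y] = [x]"
    using Aut_tree_inv_apply(2)[OF c(1), of "[x]"] axy x by simp
  have "section_at p (inv\<^bsub>Aut_tree p\<^esub> ?a) [y] = \<one>\<^bsub>Aut_tree p\<^esub>"
    using section_at_inv[OF c(1), of "[y]"] i section_at_ggs_a_pow[OF x] y by simp
  thus "section_at p ?g [x] = section_at p ?b [y]"
    using section_at_mult[OF c(3,2), of "[x]"] section_at_mult[OF c(1) ggs_b_closed, of "[x]"]
      section_at_ggs_a_pow[OF x, of ?k] axy x y section_at_closed[OF ggs_b_closed, of "[y]" p e]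
    by (simp add: Aut_tree_mult_apply ggs_b_letter)
qed

lemma subgroup_level_stabilizer_sections:
  assumes G: "subgroup G (Aut_tree p)" and u: "u \<in> level p n"
  shows "subgroup ((\<lambda>g. section_at p g u) ` level_stabilizer p G n) (Aut_tree p)"
proof (rule Aut.subgroupI)
  let ?S = "level_stabilizer p G n"
  have uw: "u \<in> words p" using u by (simp add: level_def)
  have S: "g \<in> carrier (Aut_tree p) \<and> g u = u" if "g \<in> ?S" for g
    using that subgroup.mem_carrier[OF G] u by (auto simp: level_stabilizer_def)
  show "(\<lambda>g. section_at p g u) ` ?S \<subseteq> carrier (Aut_tree p)"
    using S section_at_closed uw by blast
  have "\<one>\<^bsub>Aut_tree p\<^esub> \<in> ?S"
    using subgroup.one_closed[OF G] by (auto simp: level_stabilizer_def level_def Aut_tree_one_apply)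
  thus "(\<lambda>g. section_at p g u) ` ?S \<noteq> {}" by blast
  {
    fix s assume "s \<in> (\<lambda>g. section_at p g u) ` ?S"
    then obtain g where g: "g \<in> ?S" "s = section_at p g u" by blast
    have i: "(inv\<^bsub>Aut_tree p\<^esub> g) v = v" if "v \<in> level p n" for v
    proof -
      have "g v = v" "v \<in> words p" using g(1) that by (auto simp: level_stabilizer_def level_def)
      thus ?thesis using Aut_tree_inv_apply(2)[of g p v] S[OF g(1)] by simp
    qed
    hence "inv\<^bsub>Aut_tree p\<^esub> g \<in> ?S"
      using g(1) subgroup.m_inv_closed[OF G] by (auto simp: level_stabilizer_def)
    moreover have "section_at p (inv\<^bsub>Aut_tree p\<^esub> g) u = inv\<^bsub>Aut_tree p\<^esub> s"
      using section_at_inv[of g p u] S[OF g(1)] uw i[OF u] g(2) by simp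
    ultimately show "inv\<^bsub>Aut_tree p\<^esub> s \<in> (\<lambda>g. section_at p g u) ` ?S" by (metis imageI)
  next
    fix s t assume "s \<in> (\<lambda>g. section_at p g u) ` ?S" "t \<in> (\<lambda>g. section_at p g u) ` ?S"
    then obtain g h where gh: "g \<in> ?S" "s = section_at p g u" "h \<in> ?S" "t = section_at p h u"
      by blast
    have "g \<otimes>\<^bsub>Aut_tree p\<^esub> h \<in> ?S"
      using gh(1,3) subgroup.m_closed[OF G]
      by (auto simp: level_stabilizer_def level_def Aut_tree_mult_apply)
    moreover have "section_at p (g \<otimes>\<^bsub>Aut_tree p\<^esub> h) u = s \<otimes>\<^bsub>Aut_tree p\<^esub> t"
      using section_at_mult[of g p h u] S[OF gh(1)] S[OF gh(3)] gh(2,4) uw by simp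
    ultimately show "s \<otimes>\<^bsub>Aut_tree p\<^esub> t \<in> (\<lambda>g. section_at p g u) ` ?S" by (metis imageI)
  }
qed

text \<open>The sections at \<open>x\<close> of the first-level stabilizer form a group. It contains all first-level
  sections of \<open>b\<close>, that is \<open>b\<close> and the powers of \<open>a\<close> with exponents \<open>e i\<close>; some \<open>e i\<close> is
  invertible modulo the prime \<open>p\<close>, so the group contains \<open>a\<close> as well.\<close>

lemma strongly_fractal_GGS:
  assumes p: "prime p" and e: "defining_vector p e"
  shows "strongly_fractal p (GGS_group p e)"
  unfolding strongly_fractal_def
proof (intro conjI ballI)
  let ?G = "GGS_group p e"
  show ss: "self_similar p ?G" by (rule self_similar_GGS)
  fix x assume x: "x \<in> alphabet p"
  let ?I = "(\<lambda>g. section_at p g [x]) ` level_stabilizer p ?G 1"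
  have I: "subgroup ?I (Aut_tree p)"
    using x by (intro subgroup_level_stabilizer_sections subgroup_GGS) (simp add: level_def)
  have sect: "section_at p (ggs_b p e) [y] \<in> ?I" if y: "y \<in> alphabet p" for y
    using ggs_b_section_transport[OF x y, of e] by (metis imageI)
  have p0: "p > 0" using p by (rule prime_gt_0_nat)
  have b: "ggs_b p e \<in> ?I"
    using sect[of p] p0 by (simp add: alphabet_def section_at_ggs_b_last)
  obtain i where i: "i \<in> {1..p-1}" "e i \<noteq> 0" "e i \<in> {0..int p - 1}"
    using e by (force simp: defining_vector_def residue_ring_def PiE_def)
  have pi: "prime (int p)" using p by simp
  have "\<not> int p dvd e i" using i(2,3) zdvd_not_zless[of "e i" "int p"] by auto
  hence "coprime (e i) (int p)" using prime_imp_coprime[OF pi] coprime_commute by blast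
  then obtain d where d: "[e i * d = 1] (mod int p)" using cong_solve_coprime_int by blast
  have "i \<in> alphabet p" "i \<noteq> p" using i(1) p0 by (auto simp: alphabet_def)
  hence "ggs_a p [^]\<^bsub>Aut_tree p\<^esub> e i \<in> ?I" using sect[of i] by (simp add: section_at_ggs_b)
  hence "(ggs_a p [^]\<^bsub>Aut_tree p\<^esub> e i) [^]\<^bsub>Aut_tree p\<^esub> d \<in> ?I"
    by (rule Aut.subgroup_int_pow_closed[OF I])
  moreover have "(ggs_a p [^]\<^bsub>Aut_tree p\<^esub> e i) [^]\<^bsub>Aut_tree p\<^esub> d = ggs_a p"
    using ggs_a_pow_cong[OF p0 d] by (simp add: Aut.int_pow_pow ggs_a_closed ggs_a_pow_1)
  ultimately have "ggs_a p \<in> ?I" by simp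
  hence "?G \<subseteq> ?I" using GGS_subset[OF I] b by blast
  moreover have "?I \<subseteq> ?G"
    using ss x by (auto simp: self_similar_def level_stabilizer_def)
  ultimately show "?I = ?G" by blast
qed


section \<open>Rotation numbers\<close>

text \<open>The letter \<open>p\<close> represents zero, so its image is the amount of the rotation, for an
  automorphism that does rotate the first level. Only the class modulo \<open>p\<close> has a meaning.\<close>

definition rot :: "nat \<Rightarrow> (nat list \<Rightarrow> nat list) \<Rightarrow> int" where
  "rot p g = int (hd (g [p]))"

definition rotations :: "nat \<Rightarrow> (nat list \<Rightarrow> nat list) set" where
  "rotations p = {g \<in> carrier (Aut_tree p).
     \<forall>x\<in>alphabet p. [int (hd (g [x])) = int x + rot p g] (mod int p)}"

text \<open>For prime \<open>p\<close> this is the standard Sylow pro-\<open>p\<close> subgroup of the automorphism group.\<close>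

definition locally_cyclic :: "nat \<Rightarrow> (nat list \<Rightarrow> nat list) set" where
  "locally_cyclic p =
     {g \<in> carrier (Aut_tree p). \<forall>u\<in>words p. section_at p g u \<in> rotations p}"

definition section_rot :: "nat \<Rightarrow> (nat list \<Rightarrow> nat list) \<Rightarrow> int" where
  "section_rot p g = (\<Sum>x\<in>alphabet p. rot p (section_at p g [x]))"

lemma rotationsI:
  assumes p: "p > 0" and g: "g \<in> carrier (Aut_tree p)"
    and k: "\<And>x. x \<in> alphabet p \<Longrightarrow> [int (hd (g [x])) = int x + k] (mod int p)"
  shows "g \<in> rotations p" "[rot p g = k] (mod int p)"
proof -
  have "p \<in> alphabet p" using p by (simp add: alphabet_def)
  from k[OF this] show r: "[rot p g = k] (mod int p)" by (simp add: rot_def cong_def)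
  have "[int (hd (g [x])) = int x + rot p g] (mod int p)" if "x \<in> alphabet p" for x
    using k[OF that] cong_add[OF cong_refl cong_sym[OF r]] by (rule cong_trans)
  thus "g \<in> rotations p" using g by (simp add: rotations_def)
qed

lemma rotations_mult:
  assumes p: "p > 0" and f: "f \<in> rotations p" and g: "g \<in> rotations p"
  shows "f \<otimes>\<^bsub>Aut_tree p\<^esub> g \<in> rotations p"
    "[rot p (f \<otimes>\<^bsub>Aut_tree p\<^esub> g) = rot p f + rot p g] (mod int p)"
proof -
  have c: "f \<in> carrier (Aut_tree p)" "g \<in> carrier (Aut_tree p)"
    using f g by (auto simp: rotations_def)
  have k: "[int (hd ((f \<otimes>\<^bsub>Aut_tree p\<^esub> g) [x])) = int x + (rot p f + rot p g)] (mod int p)"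
    if x: "x \<in> alphabet p" for x
  proof -
    obtain y where y: "y \<in> alphabet p" "f [x] = [y]" using Aut_tree_letter[OF c(1) x] .
    have "[int y = int x + rot p f] (mod int p)" using f x y by (auto simp: rotations_def)
    moreover have "[int (hd (g [y])) = int y + rot p g] (mod int p)"
      using g y by (auto simp: rotations_def)
    ultimately have "[int (hd (g [y])) = int x + rot p f + rot p g] (mod int p)"
      by (metis cong_add_rcancel cong_trans)
    thus ?thesis using x y by (simp add: Aut_tree_mult_apply add.assoc)
  qed
  show "f \<otimes>\<^bsub>Aut_tree p\<^esub> g \<in> rotations p"
    "[rot p (f \<otimes>\<^bsub>Aut_tree p\<^esub> g) = rot p f + rot p g] (mod int p)"
    using rotationsI[OF p _ k] c by auto
qed

lemma rotations_one:
  assumes "p > 0"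
  shows "\<one>\<^bsub>Aut_tree p\<^esub> \<in> rotations p" "[rot p \<one>\<^bsub>Aut_tree p\<^esub> = 0] (mod int p)"
  using rotationsI[OF assms, of "\<one>\<^bsub>Aut_tree p\<^esub>" 0] by (auto simp: Aut_tree_one_apply)

lemma subgroup_rotations:
  assumes p: "p > 0"
  shows "subgroup (rotations p) (Aut_tree p)"
proof (rule Aut.subgroupI)
  fix g assume g: "g \<in> rotations p"
  hence c: "g \<in> carrier (Aut_tree p)" "inv\<^bsub>Aut_tree p\<^esub> g \<in> carrier (Aut_tree p)"
    by (auto simp: rotations_def)
  show "inv\<^bsub>Aut_tree p\<^esub> g \<in> rotations p"
  proof (rule rotationsI(1)[OF p c(2)])
    fix y assume y: "y \<in> alphabet p"
    obtain x where x: "x \<in> alphabet p" "(inv\<^bsub>Aut_tree p\<^esub> g) [y] = [x]"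
      using Aut_tree_letter[OF c(2) y] .
    have "g [x] = [y]" using Aut_tree_inv_apply(1)[OF c(1), of "[y]"] x y by simp
    hence "[int y = int x + rot p g] (mod int p)" using g x by (auto simp: rotations_def)
    from cong_sym[OF cong_diff[OF this cong_refl[of "rot p g"]]]
    show "[int (hd ((inv\<^bsub>Aut_tree p\<^esub> g) [y])) = int y + - rot p g] (mod int p)"
      using x by simp
  qed
qed (use rotations_one[OF p] rotations_mult[OF p] in \<open>auto simp: rotations_def\<close>)

lemma subgroup_locally_cyclic:
  assumes "p > 0"
  shows "subgroup (locally_cyclic p) (Aut_tree p)"
  unfolding locally_cyclic_def
  by (rule subgroup_sections_in[OF subgroup_rotations[OF assms]]) (auto simp: Aut_tree_memD(4))

lemma locally_cyclic_carrier: "g \<in> locally_cyclic p \<Longrightarrow> g \<in> carrier (Aut_tree p)"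
  by (simp add: locally_cyclic_def)

lemma locally_cyclic_section:
  assumes "g \<in> locally_cyclic p" "u \<in> words p"
  shows "section_at p g u \<in> locally_cyclic p"
  using assms
  by (auto simp: locally_cyclic_def section_at_closed section_at_append[symmetric])

lemma locally_cyclic_rotations:
  assumes "g \<in> locally_cyclic p"
  shows "g \<in> rotations p"
proof -
  have "section_at p g [] \<in> rotations p" using assms by (simp add: locally_cyclic_def)
  thus ?thesis using section_at_Nil[OF locally_cyclic_carrier[OF assms]] by simp
qed

lemma locally_cyclicI:
  assumes "g \<in> rotations p" "\<And>x. x \<in> alphabet p \<Longrightarrow> section_at p g [x] \<in> locally_cyclic p"
  shows "g \<in> locally_cyclic p"
proof -
  have c: "g \<in> carrier (Aut_tree p)" using assms(1) by (simp add: rotations_def)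
  have "section_at p g u \<in> rotations p" if u: "u \<in> words p" for u
  proof (cases u)
    case Nil
    thus ?thesis using section_at_Nil[OF c] assms(1) by simp
  next
    case (Cons x w)
    hence "section_at p g u = section_at p (section_at p g [x]) w"
      using section_at_append[OF c, of "[x]" w] u by simp
    thus ?thesis using assms(2)[of x] Cons u by (simp add: locally_cyclic_def)
  qed
  thus ?thesis using c by (simp add: locally_cyclic_def)
qed

lemma ggs_a_pow_rotation:
  assumes p: "p > 0"
  shows "ggs_a p [^]\<^bsub>Aut_tree p\<^esub> k \<in> rotations p"
    "[rot p (ggs_a p [^]\<^bsub>Aut_tree p\<^esub> (k::int)) = k] (mod int p)"
proof -
  have k: "[int (hd ((ggs_a p [^]\<^bsub>Aut_tree p\<^esub> k) [x])) = int x + k] (mod int p)"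
    if x: "x \<in> alphabet p" for x
  proof -
    obtain y where y: "y \<in> alphabet p" "[int y = int x + k] (mod int p)"
      using p by (rule alphabet_residue)
    thus ?thesis using ggs_a_pow_Cons[OF x _ y, of "[]"] by simp
  qed
  show "ggs_a p [^]\<^bsub>Aut_tree p\<^esub> k \<in> rotations p"
    "[rot p (ggs_a p [^]\<^bsub>Aut_tree p\<^esub> k) = k] (mod int p)"
    using rotationsI[OF p ggs_a_pow_closed k] by auto
qed

lemma ggs_b_rotation:
  assumes p: "p > 0"
  shows "ggs_b p e \<in> rotations p" "[rot p (ggs_b p e) = 0] (mod int p)"
  using rotationsI[OF p ggs_b_closed, of e 0] by (auto simp: ggs_b_letter)

lemma ggs_a_pow_locally_cyclic:
  assumes p: "p > 0"
  shows "ggs_a p [^]\<^bsub>Aut_tree p\<^esub> (k::int) \<in> locally_cyclic p"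
proof (rule locally_cyclicI[OF ggs_a_pow_rotation(1)[OF p]])
  show "section_at p (ggs_a p [^]\<^bsub>Aut_tree p\<^esub> k) [x] \<in> locally_cyclic p"
    if "x \<in> alphabet p" for x
    using that subgroup.one_closed[OF subgroup_locally_cyclic[OF p]]
    by (simp add: section_at_ggs_a_pow)
qed

text \<open>The section of \<open>b\<close> at \<open>p\<close> is \<open>b\<close> again, so the claim about \<open>b\<close> cannot be reduced to its
  first-level sections; the induction is on the vertex.\<close>

lemma ggs_b_locally_cyclic:
  assumes p: "p > 0"
  shows "ggs_b p e \<in> locally_cyclic p"
proof -
  have "section_at p (ggs_b p e) u \<in> rotations p" if "u \<in> words p" for u
    using that
  proof (induction u)
    case Nil
    show ?case using section_at_Nil[OF ggs_b_closed] ggs_b_rotation[OF p] by simp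
  next
    case (Cons x u)
    have "section_at p (ggs_b p e) (x # u) = section_at p (section_at p (ggs_b p e) [x]) u"
      using section_at_append[OF ggs_b_closed, of "[x]" p u e] Cons.prems by simp
    thus ?case using Cons ggs_a_pow_locally_cyclic[OF p, of "e x"]
      by (auto simp: section_at_ggs_b_cases locally_cyclic_def)
  qed
  thus ?thesis by (simp add: locally_cyclic_def ggs_b_closed)
qed


section \<open>The weight modulo p\<close>

text \<open>The rotation number and the sum of the rotation numbers on the first level are two
  homomorphisms from the locally cyclic automorphisms to \<open>\<int>/p\<int>\<close>. Their difference is chosen to
  send \<open>a\<close> to \<open>1\<close> and, for a defining vector with all entries \<open>c\<close>, to send \<open>b\<close> to \<open>c\<close>, the same
  value as \<open>a\<^sup>c\<close>; so the weight does not distinguish the first-level sections of \<open>b\<close>.\<close>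

definition weight :: "nat \<Rightarrow> (nat list \<Rightarrow> nat list) \<Rightarrow> int" where
  "weight p g = rot p g - section_rot p g"

text \<open>By the product rule for sections; the vertices at which the sections of \<open>g\<close> are taken
  are permuted by \<open>f\<close>, and this does not change the sum over the level.\<close>

lemma section_rot_mult:
  assumes p: "p > 0" and f: "f \<in> locally_cyclic p" and g: "g \<in> locally_cyclic p"
  shows "[section_rot p (f \<otimes>\<^bsub>Aut_tree p\<^esub> g) = section_rot p f + section_rot p g] (mod int p)"
proof -
  note c = f[THEN locally_cyclic_carrier] g[THEN locally_cyclic_carrier]
  define \<pi> where "\<pi> x = hd (f [x])" for x
  have \<pi>: "\<pi> x \<in> alphabet p" "f [x] = [\<pi> x]" if "x \<in> alphabet p" for x
    using Aut_tree_snoc[OF c(1), of "[]" x] that Aut_tree_memD(3)[OF c(1)] by (auto simp: \<pi>_def)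
  have inj: "inj_on \<pi> (alphabet p)"
  proof (rule inj_onI)
    fix x y assume "x \<in> alphabet p" "y \<in> alphabet p" "\<pi> x = \<pi> y"
    thus "x = y" using \<pi> Aut_tree_memD(5)[OF c(1), of "[x]" "[y]"] by simp
  qed
  have fin: "finite (alphabet p)" by (simp add: alphabet_def)
  have "\<pi> ` alphabet p \<subseteq> alphabet p" using \<pi>(1) by blast
  hence bij: "bij_betw \<pi> (alphabet p) (alphabet p)"
    using endo_inj_surj[OF fin _ inj] inj by (simp add: bij_betw_def)
  have "[rot p (section_at p (f \<otimes>\<^bsub>Aut_tree p\<^esub> g) [x]) =
         rot p (section_at p f [x]) + rot p (section_at p g [\<pi> x])] (mod int p)"
    if x: "x \<in> alphabet p" for x
  proof -
    have "section_at p f [x] \<in> rotations p" "section_at p g [\<pi> x] \<in> rotations p"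
      using f g x \<pi>(1)[OF x] by (auto simp: locally_cyclic_def)
    thus ?thesis using rotations_mult(2)[OF p] section_at_mult[OF c, of "[x]"] x \<pi>(2)[OF x] by simp
  qed
  hence "[section_rot p (f \<otimes>\<^bsub>Aut_tree p\<^esub> g) =
    (\<Sum>x\<in>alphabet p. rot p (section_at p f [x]) + rot p (section_at p g [\<pi> x]))] (mod int p)"
    unfolding section_rot_def by (rule cong_sum)
  also have "(\<Sum>x\<in>alphabet p. rot p (section_at p f [x]) + rot p (section_at p g [\<pi> x])) =
    section_rot p f + section_rot p g"
    using sum.reindex_bij_betw[OF bij, of "\<lambda>y. rot p (section_at p g [y])"]
    by (simp add: section_rot_def sum.distrib)
  finally show ?thesis .
qed

lemma section_rot_eq_0:
  assumes "\<And>x. x \<in> alphabet p \<Longrightarrow> [rot p (section_at p g [x]) = 0] (mod int p)"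
  shows "[section_rot p g = 0] (mod int p)"
  using cong_sum[of "alphabet p" "\<lambda>x. rot p (section_at p g [x])" "\<lambda>_. 0" "int p"] assms
  by (simp add: section_rot_def)

lemma section_rot_one:
  assumes "p > 0"
  shows "[section_rot p \<one>\<^bsub>Aut_tree p\<^esub> = 0] (mod int p)"
  using section_rot_eq_0[of p "\<one>\<^bsub>Aut_tree p\<^esub>"] section_at_one rotations_one(2)[OF assms] by simp

lemma weight_mult:
  assumes p: "p > 0" and f: "f \<in> locally_cyclic p" and g: "g \<in> locally_cyclic p"
  shows "[weight p (f \<otimes>\<^bsub>Aut_tree p\<^esub> g) = weight p f + weight p g] (mod int p)"
  using cong_diff[OF rotations_mult(2)[OF p locally_cyclic_rotations[OF f]
        locally_cyclic_rotations[OF g]] section_rot_mult[OF p f g]]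
  by (simp add: weight_def algebra_simps)

lemma weight_one: "p > 0 \<Longrightarrow> [weight p \<one>\<^bsub>Aut_tree p\<^esub> = 0] (mod int p)"
  using cong_diff[OF rotations_one(2) section_rot_one, of p] by (simp add: weight_def)

lemma additive_inv:
  fixes h :: "(nat list \<Rightarrow> nat list) \<Rightarrow> int"
  assumes p: "p > 0" and g: "g \<in> locally_cyclic p"
    and mult: "\<And>f g. f \<in> locally_cyclic p \<Longrightarrow> g \<in> locally_cyclic p \<Longrightarrow>
      [h (f \<otimes>\<^bsub>Aut_tree p\<^esub> g) = h f + h g] (mod int p)"
    and one: "[h \<one>\<^bsub>Aut_tree p\<^esub> = 0] (mod int p)"
  shows "[h (inv\<^bsub>Aut_tree p\<^esub> g) = - h g] (mod int p)"
proof -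
  have "inv\<^bsub>Aut_tree p\<^esub> g \<in> locally_cyclic p"
    using subgroup.m_inv_closed[OF subgroup_locally_cyclic[OF p] g] .
  hence "[h \<one>\<^bsub>Aut_tree p\<^esub> = h (inv\<^bsub>Aut_tree p\<^esub> g) + h g] (mod int p)"
    using mult[of "inv\<^bsub>Aut_tree p\<^esub> g" g] g locally_cyclic_carrier[OF g] by simp
  hence "[h (inv\<^bsub>Aut_tree p\<^esub> g) + h g = 0] (mod int p)"
    using one by (blast intro: cong_trans cong_sym)
  thus ?thesis by (simp add: cong_iff_dvd_diff)
qed

text \<open>In a GGS-group with all entries \<open>c\<close>, each side is \<open>c\<close> times the exponent sum of \<open>b\<close> in
  a word for \<open>g\<close>: the factors \<open>a\<close> contribute trivial sections, and each factor \<open>b\<close> contributes a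
  section of weight \<open>c\<close>, whichever vertex it is taken at.\<close>

definition weight_balanced :: "nat \<Rightarrow> (nat list \<Rightarrow> nat list) set" where
  "weight_balanced p = {g \<in> locally_cyclic p.
     \<forall>x\<in>alphabet p. [weight p (section_at p g [x]) = - section_rot p g] (mod int p)}"

lemma subgroup_weight_balanced:
  assumes p: "p > 0"
  shows "subgroup (weight_balanced p) (Aut_tree p)"
proof (rule Aut.subgroupI)
  note lc = subgroup_locally_cyclic[OF p]
  show "weight_balanced p \<subseteq> carrier (Aut_tree p)"
    by (auto simp: weight_balanced_def locally_cyclic_carrier)
  have "[weight p \<one>\<^bsub>Aut_tree p\<^esub> = - section_rot p \<one>\<^bsub>Aut_tree p\<^esub>] (mod int p)"
    using cong_trans[OF weight_one[OF p] cong_sym] section_rot_one[OF p] cong_minus_minus_iff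
    by (metis minus_zero)
  hence "\<one>\<^bsub>Aut_tree p\<^esub> \<in> weight_balanced p"
    using subgroup.one_closed[OF lc] by (simp add: weight_balanced_def section_at_one)
  thus "weight_balanced p \<noteq> {}" by blast
next
  fix g assume g: "g \<in> weight_balanced p"
  hence gl: "g \<in> locally_cyclic p" by (simp add: weight_balanced_def)
  let ?i = "inv\<^bsub>Aut_tree p\<^esub> g"
  have i: "?i \<in> locally_cyclic p"
    using subgroup.m_inv_closed[OF subgroup_locally_cyclic[OF p] gl] .
  have "[weight p (section_at p ?i [x]) = - section_rot p ?i] (mod int p)"
    if x: "x \<in> alphabet p" for x
  proof -
    obtain y where y: "y \<in> alphabet p" "?i [x] = [y]"
      using Aut_tree_letter[OF locally_cyclic_carrier[OF i] x] .
    have "section_at p ?i [x] = inv\<^bsub>Aut_tree p\<^esub> (section_at p g [y])"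
      using section_at_inv[OF locally_cyclic_carrier[OF gl], of "[x]"] x y by simp
    hence "[weight p (section_at p ?i [x]) = - weight p (section_at p g [y])] (mod int p)"
      using additive_inv[OF p locally_cyclic_section[OF gl, of "[y]"], of "weight p"]
        weight_mult[OF p] weight_one[OF p] y by simp
    moreover have "[weight p (section_at p g [y]) = - section_rot p g] (mod int p)"
      using g y by (simp add: weight_balanced_def)
    moreover have "[section_rot p ?i = - section_rot p g] (mod int p)"
      using additive_inv[OF p gl, of "section_rot p"] section_rot_mult[OF p] section_rot_one[OF p]
      by blast
    ultimately show ?thesis by (meson cong_minus_minus_iff cong_sym cong_trans)
  qed
  thus "?i \<in> weight_balanced p" using i by (simp add: weight_balanced_def)
next
  fix f g assume f: "f \<in> weight_balanced p" and g: "g \<in> weight_balanced p"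
  hence l: "f \<in> locally_cyclic p" "g \<in> locally_cyclic p" by (auto simp: weight_balanced_def)
  note c = l[THEN locally_cyclic_carrier]
  let ?m = "f \<otimes>\<^bsub>Aut_tree p\<^esub> g"
  have "[weight p (section_at p ?m [x]) = - section_rot p ?m] (mod int p)"
    if x: "x \<in> alphabet p" for x
  proof -
    obtain y where y: "y \<in> alphabet p" "f [x] = [y]" using Aut_tree_letter[OF c(1) x] .
    have "[weight p (section_at p ?m [x]) =
           weight p (section_at p f [x]) + weight p (section_at p g [y])] (mod int p)"
      using weight_mult[OF p locally_cyclic_section[OF l(1), of "[x]"]
          locally_cyclic_section[OF l(2), of "[y]"]] section_at_mult[OF c, of "[x]"] x y by simp
    moreover have "[weight p (section_at p f [x]) + weight p (section_at p g [y]) =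
        - section_rot p f + - section_rot p g] (mod int p)"
      using f g x y by (intro cong_add) (auto simp: weight_balanced_def)
    moreover have "[- section_rot p f + - section_rot p g = - section_rot p ?m] (mod int p)"
      using cong_sym[OF section_rot_mult[OF p l]] cong_minus_minus_iff
      by (metis minus_add_distrib)
    ultimately show ?thesis by (meson cong_trans)
  qed
  thus "?m \<in> weight_balanced p"
    using subgroup.m_closed[OF subgroup_locally_cyclic[OF p] l] by (simp add: weight_balanced_def)
qed

lemma weight_ggs_a_pow:
  assumes p: "p > 0"
  shows "[section_rot p (ggs_a p [^]\<^bsub>Aut_tree p\<^esub> (k::int)) = 0] (mod int p)"
    "[weight p (ggs_a p [^]\<^bsub>Aut_tree p\<^esub> k) = k] (mod int p)"
proof -
  show s: "[section_rot p (ggs_a p [^]\<^bsub>Aut_tree p\<^esub> k) = 0] (mod int p)"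
    by (rule section_rot_eq_0) (simp add: section_at_ggs_a_pow rotations_one(2)[OF p])
  show "[weight p (ggs_a p [^]\<^bsub>Aut_tree p\<^esub> k) = k] (mod int p)"
    using cong_diff[OF ggs_a_pow_rotation(2)[OF p] s] by (simp add: weight_def)
qed

text \<open>Here constancy enters: \<open>p - 1\<close> sections of rotation number \<open>c\<close> sum up to \<open>- c\<close>
  modulo \<open>p\<close>.\<close>

lemma weight_ggs_b:
  assumes p: "p > 0" and e: "\<And>x. x \<in> {1..p-1} \<Longrightarrow> e x = c"
  shows "[section_rot p (ggs_b p e) = - c] (mod int p)" "[weight p (ggs_b p e) = c] (mod int p)"
proof -
  have x: "[rot p (section_at p (ggs_b p e) [x]) = (if x = p then 0 else c)] (mod int p)"
    if "x \<in> alphabet p" for x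
  proof (cases "x = p")
    case True
    thus ?thesis using ggs_b_rotation(2)[OF p] that by (simp add: section_at_ggs_b_cases)
  next
    case False
    hence "e x = c" using that by (intro e) (auto simp: alphabet_def)
    thus ?thesis using False ggs_a_pow_rotation(2)[OF p, of c] that
      by (simp add: section_at_ggs_b_cases)
  qed
  have "[section_rot p (ggs_b p e) = (\<Sum>x\<in>alphabet p. if x = p then 0 else c)] (mod int p)"
    unfolding section_rot_def using x by (rule cong_sum)
  also have "(\<Sum>x\<in>alphabet p. if x = p then 0 else c) = (\<Sum>x\<in>alphabet p - {p}. c)"
    by (rule sum.mono_neutral_cong_right) (auto simp: alphabet_def)
  also have "\<dots> = (int p - 1) * c" using p by (simp add: alphabet_def of_nat_diff)
  also have "[\<dots> = - c] (mod int p)" by (simp add: cong_iff_dvd_diff algebra_simps)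
  finally show s: "[section_rot p (ggs_b p e) = - c] (mod int p)" .
  show "[weight p (ggs_b p e) = c] (mod int p)"
    using cong_diff[OF ggs_b_rotation(2)[OF p] s] by (simp add: weight_def)
qed

lemma GGS_weight_balanced:
  assumes p: "p > 0" and e: "\<And>x. x \<in> {1..p-1} \<Longrightarrow> e x = c"
  shows "GGS_group p e \<subseteq> weight_balanced p"
proof (rule GGS_subset[OF subgroup_weight_balanced[OF p]])
  have neg: "[u = - v] (mod int p)" if "[u = w] (mod int p)" "[v = - w] (mod int p)" for u v w
    using that by (metis cong_minus_minus_iff cong_sym cong_trans minus_minus)
  have "ggs_a p \<in> locally_cyclic p"
    using ggs_a_pow_locally_cyclic[OF p, of 1] by (simp add: ggs_a_pow_1)
  moreover have "[section_rot p (ggs_a p) = - 0] (mod int p)"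
    using weight_ggs_a_pow(1)[OF p, of 1] by (simp add: ggs_a_pow_1)
  ultimately show "ggs_a p \<in> weight_balanced p"
    using neg[OF weight_one[OF p]] by (auto simp: weight_balanced_def section_at_ggs_a)
  have s: "[section_rot p (ggs_b p e) = - c] (mod int p)" using p e by (rule weight_ggs_b(1))
  have "[weight p (section_at p (ggs_b p e) [x]) = c] (mod int p)" if x: "x \<in> alphabet p" for x
  proof (cases "x = p")
    case True
    thus ?thesis using weight_ggs_b(2)[OF p e] x by (simp add: section_at_ggs_b_cases)
  next
    case False
    hence "e x = c" using x by (intro e) (auto simp: alphabet_def)
    thus ?thesis using False weight_ggs_a_pow(2)[OF p, of c] x
      by (simp add: section_at_ggs_b_cases)
  qed
  thus "ggs_b p e \<in> weight_balanced p"
    using neg[OF _ s] ggs_b_locally_cyclic[OF p, of e] by (simp add: weight_balanced_def)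
qed

text \<open>An element \<open>h\<close> with rotation number zero has weight \<open>- section_rot p h\<close>, which is also the
  weight of each of its first-level sections if \<open>h\<close> is balanced. For \<open>g\<close> fixing the second level
  this applies to \<open>g\<close> and to its first-level sections, so the second-level sections have the weight
  of \<open>g\<close>. That weight vanishes, because \<open>g\<close> does not rotate at the root or on the first level.\<close>

lemma level_stabilizer_2_section_weight:
  assumes p: "p > 0" and ss: "self_similar p G" and G: "G \<subseteq> weight_balanced p"
    and g: "g \<in> level_stabilizer p G 2" and u: "u \<in> level p 2"
  shows "[weight p (section_at p g u) = 0] (mod int p)"
proof -
  obtain x y where xy: "u = [x, y]" "x \<in> alphabet p" "y \<in> alphabet p"
    using u by (auto simp: level_def numeral_2_eq_2 length_Suc_conv)
  have gG: "g \<in> G" using g by (simp add: level_stabilizer_def)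
  hence gw: "g \<in> weight_balanced p" using G by blast
  hence c: "g \<in> carrier (Aut_tree p)" by (simp add: weight_balanced_def locally_cyclic_carrier)
  have fixes2: "section_at p g [z] [t] = [t]" if "z \<in> alphabet p" "t \<in> alphabet p" for z t
  proof -
    have "g [z, t] = [z, t]" using g that by (auto simp: level_stabilizer_def level_def)
    moreover have "g ([z] @ [t]) = g [z] @ section_at p g [z] [t]"
      using that by (intro section_at_eq c) auto
    moreover have "length (g [z]) = length [z]" using that by (intro Aut_tree_length[OF c]) simp
    ultimately show ?thesis by (auto simp: length_Suc_conv)
  qed
  have rot0: "[rot p (section_at p g [z]) = 0] (mod int p)" if "z \<in> alphabet p" for z
    using rotationsI(2)[OF p section_at_closed[OF c], of "[z]" 0] fixes2 that by simp
  let ?s = "section_at p g [x]"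
  have "?s \<in> weight_balanced p" using ss G gG xy by (auto simp: self_similar_def)
  hence "[weight p (section_at p ?s [y]) = - section_rot p ?s] (mod int p)"
    using xy by (simp add: weight_balanced_def)
  also have "[- section_rot p ?s = weight p ?s] (mod int p)"
    using cong_sym[OF cong_diff[OF rot0[OF xy(2)] cong_refl]] by (simp add: weight_def)
  also have "[weight p ?s = - section_rot p g] (mod int p)"
    using gw xy by (simp add: weight_balanced_def)
  also have "[- section_rot p g = 0] (mod int p)"
    using section_rot_eq_0[OF rot0] cong_minus_minus_iff by (metis minus_zero)
  finally show ?thesis using section_at_append[OF c, of "[x]" "[y]"] xy by simp
qed

theorem proposition4p3:
  fixes p :: nat and e :: "nat \<Rightarrow> int"
  assumes "prime p"
    and "defining_vector p e"
    and "constant_vector p e"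
  shows "strongly_fractal p (GGS_group p e) \<and> \<not> super_strongly_fractal p (GGS_group p e)"
proof
  let ?G = "GGS_group p e"
  show "strongly_fractal p ?G" using assms(1,2) by (rule strongly_fractal_GGS)
  have p: "p > 0" "p > 1"
    using prime_gt_0_nat[OF assms(1)] prime_gt_1_nat[OF assms(1)] by auto
  have e: "e x = e 1" if "x \<in> {1..p-1}" for x
  proof -
    have "1 \<in> {1..p-1}" using p(2) by simp
    thus ?thesis using assms(3) that unfolding constant_vector_def by blast
  qed
  have G: "?G \<subseteq> weight_balanced p" using p(1) e by (rule GGS_weight_balanced)
  show "\<not> super_strongly_fractal p ?G"
  proof
    assume "super_strongly_fractal p ?G"
    moreover have u: "[p, p] \<in> level p 2" using p by (simp add: level_def alphabet_def)
    ultimately have "ggs_a p \<in> (\<lambda>g. section_at p g [p, p]) ` level_stabilizer p ?G 2"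
      using ggs_generators_in(1) unfolding super_strongly_fractal_def by blast
    hence "[weight p (ggs_a p) = 0] (mod int p)"
      using level_stabilizer_2_section_weight[OF p(1) self_similar_GGS G _ u] by auto
    moreover have "[weight p (ggs_a p) = 1] (mod int p)"
      using weight_ggs_a_pow(2)[OF p(1), of 1] by (simp add: ggs_a_pow_1)
    ultimately have "[1 = 0] (mod int p)" using cong_sym cong_trans by blast
    thus False using p(2) by (simp add: cong_def)
  qed
qed

end
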